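(* Let $\Delta$ be an irreducible reduced root system not of type $A_n$, with positive roots $\Delta^+$, simple roots $\Pi$ and highest root $\theta$, and let $\lfloor\theta/2\rfloor=\sum_{\alpha\in\Pi}\lfloor\mathrm{ht}_\alpha(\theta)/2\rfloor\alpha$. Then $\lfloor\theta/2\rfloor$ is a root, it is the unique maximal element of $\Delta^+_{\sf nc}$ with respect to $\preccurlyeq$, and $\lfloor\theta/2\rfloor\in\mathcal H$.
   Context: For $\mu=\sum_{\alpha\in\Pi}c_\alpha\alpha$, $\mathrm{ht}_\alpha(\mu)=c_\alpha$; $\mu\preccurlyeq\nu$ iff $\nu-\mu$ is a non-negative integral combination of simple roots. A subset $I\subset\Delta^+$ is abelian if $\gamma'+\gamma''\notin\Delta^+$ for all $\gamma',\gamma''\in I$. $\Delta^+_{\sf nc}$ is the set of $\gamma\in\Delta^+$ for which the upper ideal $\{\nu\in\Delta^+\mid\nu\succcurlyeq\gamma\}$ is not abelian. $\mathcal H=\{\gamma\in\Delta^+\mid(\gamma,\theta)>0\}$ (the Heisenberg ideal), where $(\ ,\ )$ is a $W$-invariant inner product. *)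

theory Defs
  imports "HOL-Analysis.Analysis"
begin

definition root_system :: "'a::euclidean_space set \<Rightarrow> bool" where
  "root_system R \<longleftrightarrow> finite R \<and> 0 \<notin> R \<and> span R = UNIV \<and>
     (\<forall>\<alpha>\<in>R. \<forall>\<beta>\<in>R. \<beta> - (2 * (\<beta> \<bullet> \<alpha>) / (\<alpha> \<bullet> \<alpha>)) *\<^sub>R \<alpha> \<in> R) \<and>
     (\<forall>\<alpha>\<in>R. \<forall>\<beta>\<in>R. 2 * (\<beta> \<bullet> \<alpha>) / (\<alpha> \<bullet> \<alpha>) \<in> \<int>)"

definition reduced_rs :: "'a::euclidean_space set \<Rightarrow> bool" where
  "reduced_rs R \<longleftrightarrow> (\<forall>\<alpha>\<in>R. \<forall>c::real. c *\<^sub>R \<alpha> \<in> R \<longrightarrow> c = 1 \<or> c = -1)"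

definition irreducible_rs :: "'a::euclidean_space set \<Rightarrow> bool" where
  "irreducible_rs R \<longleftrightarrow> R \<noteq> {} \<and>
     \<not> (\<exists>R1 R2. R1 \<noteq> {} \<and> R2 \<noteq> {} \<and> R1 \<union> R2 = R \<and> R1 \<inter> R2 = {} \<and>
            (\<forall>a\<in>R1. \<forall>b\<in>R2. a \<bullet> b = 0))"

(* R is of type A_n (n \<ge> 1): R is the image of the standard A_n = {e_i - e_j | i \<noteq> j, 0 \<le> i,j \<le> n}
   under a linear isomorphism onto span R, i.e. R = {v_i - v_j} for affinely independent v_0..v_n. *)
definition type_A :: "'a::euclidean_space set \<Rightarrow> bool" where
  "type_A R \<longleftrightarrow> (\<exists>n::nat. \<exists>v::nat \<Rightarrow> 'a. n \<ge> 1 \<and> inj_on v {0..n} \<and>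
      \<not> affine_dependent (v ` {0..n}) \<and>
      R = {v i - v j | i j. i \<le> n \<and> j \<le> n \<and> i \<noteq> j})"

definition is_base :: "'a::euclidean_space set \<Rightarrow> 'a set \<Rightarrow> bool" where
  "is_base R S \<longleftrightarrow> S \<subseteq> R \<and> independent S \<and> span S = span R \<and>
     (\<forall>\<beta>\<in>R. (\<exists>c. (\<forall>\<alpha>\<in>S. c \<alpha> \<in> \<int> \<and> c \<alpha> \<ge> 0) \<and> \<beta> = (\<Sum>\<alpha>\<in>S. c \<alpha> *\<^sub>R \<alpha>)) \<or>
              (\<exists>c. (\<forall>\<alpha>\<in>S. c \<alpha> \<in> \<int> \<and> c \<alpha> \<le> 0) \<and> \<beta> = (\<Sum>\<alpha>\<in>S. c \<alpha> *\<^sub>R \<alpha>)))"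

definition ht :: "'a::euclidean_space set \<Rightarrow> 'a \<Rightarrow> 'a \<Rightarrow> real" where
  "ht S \<alpha> \<mu> = representation S \<mu> \<alpha>"

definition pos_roots :: "'a::euclidean_space set \<Rightarrow> 'a set \<Rightarrow> 'a set" where
  "pos_roots R S = {\<beta>\<in>R. \<forall>\<alpha>\<in>S. ht S \<alpha> \<beta> \<ge> 0}"

definition root_le :: "'a::euclidean_space set \<Rightarrow> 'a \<Rightarrow> 'a \<Rightarrow> bool" where
  "root_le S \<mu> \<nu> \<longleftrightarrow>
     (\<exists>c. (\<forall>\<alpha>\<in>S. c \<alpha> \<in> \<int> \<and> c \<alpha> \<ge> 0) \<and> \<nu> - \<mu> = (\<Sum>\<alpha>\<in>S. c \<alpha> *\<^sub>R \<alpha>))"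

definition abelian_set :: "'a::euclidean_space set \<Rightarrow> 'a set \<Rightarrow> 'a set \<Rightarrow> bool" where
  "abelian_set R S I \<longleftrightarrow> (\<forall>\<gamma>1\<in>I. \<forall>\<gamma>2\<in>I. \<gamma>1 + \<gamma>2 \<notin> pos_roots R S)"

definition upper_ideal :: "'a::euclidean_space set \<Rightarrow> 'a set \<Rightarrow> 'a \<Rightarrow> 'a set" where
  "upper_ideal R S \<gamma> = {\<nu>\<in>pos_roots R S. root_le S \<gamma> \<nu>}"

definition nc_roots :: "'a::euclidean_space set \<Rightarrow> 'a set \<Rightarrow> 'a set" where
  "nc_roots R S = {\<gamma>\<in>pos_roots R S. \<not> abelian_set R S (upper_ideal R S \<gamma>)}"

definition heisenberg :: "'a::euclidean_space set \<Rightarrow> 'a set \<Rightarrow> 'a \<Rightarrow> 'a set" where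
  "heisenberg R S \<theta> = {\<gamma>\<in>pos_roots R S. \<gamma> \<bullet> \<theta> > 0}"

definition is_maximal_in :: "'a::euclidean_space set \<Rightarrow> 'a set \<Rightarrow> 'a \<Rightarrow> bool" where
  "is_maximal_in S T m \<longleftrightarrow> m \<in> T \<and> (\<forall>x\<in>T. root_le S m x \<longrightarrow> x = m)"

definition half_floor :: "'a::euclidean_space set \<Rightarrow> 'a \<Rightarrow> 'a" where
  "half_floor S \<theta> = (\<Sum>\<alpha>\<in>S. of_int \<lfloor>ht S \<alpha> \<theta> / 2\<rfloor> *\<^sub>R \<alpha>)"

end

theory Submission
  imports Defs
begin

text \<open>
  If \<open>\<gamma>\<close> is non-commutative, say \<open>\<gamma>1, \<gamma>2 \<succeq> \<gamma>\<close> with \<open>\<gamma>1 + \<gamma>2\<close> a root, then \<open>2\<gamma> \<preceq> \<gamma>1 + \<gamma>2 \<preceq> \<theta>\<close>, so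
  \<open>\<gamma> \<preceq> \<lfloor>\<theta>/2\<rfloor>\<close>. It remains to see that \<open>\<lfloor>\<theta>/2\<rfloor>\<close> and \<open>\<theta> - \<lfloor>\<theta>/2\<rfloor>\<close> are roots. Outside type A exactly one
  simple root \<open>\<alpha>0\<close> is not orthogonal to \<open>\<theta>\<close>, and its coefficient in \<open>\<theta>\<close> is 2. Starting from
  \<open>\<eta> = \<alpha>0\<close>, move through roots \<open>\<eta>\<close> with \<open>\<alpha>0\<close>-coefficient 1 and watch \<open>d = \<theta> - 2\<eta>\<close>, for which
  \<open>d \<bullet> \<gamma> = -2 (\<eta> \<bullet> \<gamma>)\<close> whenever \<open>\<gamma> \<noteq> \<alpha>0\<close> is simple. If some coefficient of \<open>d\<close> is at least 2, then
  \<open>d \<bullet> \<gamma> > 0\<close> for one such \<open>\<gamma>\<close> and \<open>\<eta> + \<gamma>\<close> is a root; if some coefficient is negative, then \<open>d \<bullet> \<gamma> < 0\<close>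
  for one such \<open>\<gamma>\<close> and \<open>\<eta> - \<gamma>\<close> is a root. Either move brings the coefficients of \<open>d\<close> closer to 1/2,
  so the process ends with all of them in \<open>{0, 1}\<close>, that is, with \<open>\<eta> = \<lfloor>\<theta>/2\<rfloor>\<close>; then
  \<open>\<theta> - \<eta>\<close> is minus the reflection of \<open>\<eta>\<close> in \<open>\<theta>\<close>. No classification is needed.
\<close>

subsection \<open>Roots and simple roots\<close>

locale based_root_system =
  fixes R S :: "'a::euclidean_space set"
  assumes root_system: "root_system R"
    and reduced: "reduced_rs R"
    and base: "is_base R S"
begin

lemma finite_R: "finite R" and zero_notin: "0 \<notin> R"
  and reflect: "\<lbrakk>\<alpha> \<in> R; \<beta> \<in> R\<rbrakk> \<Longrightarrow> \<beta> - (2 * (\<beta> \<bullet> \<alpha>) / (\<alpha> \<bullet> \<alpha>)) *\<^sub>R \<alpha> \<in> R"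
  and cartan_Ints: "\<lbrakk>\<alpha> \<in> R; \<beta> \<in> R\<rbrakk> \<Longrightarrow> 2 * (\<beta> \<bullet> \<alpha>) / (\<alpha> \<bullet> \<alpha>) \<in> \<int>"
  using root_system unfolding root_system_def by auto

lemma base_subset: "S \<subseteq> R" and indep: "independent S" and span_S: "span S = UNIV"
  using base root_system unfolding is_base_def root_system_def by auto

lemma base_in_R: "\<alpha> \<in> S \<Longrightarrow> \<alpha> \<in> R"
  using base_subset by auto

lemma finite_S: "finite S"
  using base_subset finite_R finite_subset by blast

lemma root_inner_pos: "\<alpha> \<in> R \<Longrightarrow> \<alpha> \<bullet> \<alpha> > 0"
  using zero_notin by auto

lemma uminus_root:
  assumes "\<alpha> \<in> R" shows "- \<alpha> \<in> R"
proof -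
  have "\<alpha> - (2 * (\<alpha> \<bullet> \<alpha>) / (\<alpha> \<bullet> \<alpha>)) *\<^sub>R \<alpha> = - \<alpha>"
    using root_inner_pos[OF assms] by (simp add: scaleR_2)
  then show ?thesis using reflect[OF assms assms] by simp
qed

text \<open>The Cartan integers \<open>p\<close> and \<open>q\<close> are negative. If one of them
  is -1, a reflection yields the sum. Otherwise \<open>p * q \<ge> 4\<close> forces equality in
  Cauchy-Schwarz, so \<open>b\<close> is a multiple of \<open>a\<close>, and reducedness leaves only
  \<open>b = - a\<close>, which \<open>nz\<close> excludes.\<close>

lemma add_root:
  assumes a: "a \<in> R" and b: "b \<in> R" and neg: "a \<bullet> b < 0" and nz: "a + b \<noteq> 0"
  shows "a + b \<in> R"
proof -
  have pa: "a \<bullet> a > 0" and pb: "b \<bullet> b > 0" using a b root_inner_pos by auto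
  obtain p q :: int where p: "2 * (b \<bullet> a) / (a \<bullet> a) = p" and q: "2 * (a \<bullet> b) / (b \<bullet> b) = q"
    using cartan_Ints[OF a b] cartan_Ints[OF b a] by (auto elim!: Ints_cases)
  have p0: "p < 0" and q0: "q < 0"
    using neg pa pb p q by (smt (verit) divide_neg_pos inner_commute of_int_0_le_iff)+
  have ba: "2 * (b \<bullet> a) = p * (a \<bullet> a)" and ab: "2 * (a \<bullet> b) = q * (b \<bullet> b)"
    using p q pa pb by (auto simp: field_simps)
  have prod: "4 * (a \<bullet> b)\<^sup>2 = (p * q) * ((a \<bullet> a) * (b \<bullet> b))"
    using arg_cong2[OF ba ab, of "(*)"] by (simp add: inner_commute power2_eq_square ac_simps)
  consider "p = -1" | "q = -1" | "p \<le> -2" "q \<le> -2" using p0 q0 by linarith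
  then show ?thesis
  proof cases
    case 1
    then show ?thesis using reflect[OF a b] p by (simp add: add.commute)
  next
    case 2
    then show ?thesis using reflect[OF b a] q by simp
  next
    case 3
    have pos: "(a \<bullet> a) * (b \<bullet> b) > 0" using pa pb by simp
    have "(-p) * (-q) \<ge> 2 * 2" using 3 by (intro mult_mono) auto
    then have "p * q \<ge> 4" by simp
    then have "real_of_int (p * q) \<ge> 4" by (metis of_int_le_iff of_int_numeral)
    then have "4 * (a \<bullet> b)\<^sup>2 \<ge> 4 * ((a \<bullet> a) * (b \<bullet> b))"
      unfolding prod using pos by (intro mult_right_mono) auto
    then have cs: "(a \<bullet> b)\<^sup>2 = (a \<bullet> a) * (b \<bullet> b)"
      using Cauchy_Schwarz_ineq[of a b] by linarith
    \<comment> \<open>The coefficient of the orthogonal projection of \<open>b\<close> onto the line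
      of \<open>a\<close>; the equality \<open>cs\<close> makes the remainder vanish.\<close>
    define c where "c = (a \<bullet> b) / (a \<bullet> a)"
    have "(b - c *\<^sub>R a) \<bullet> (b - c *\<^sub>R a) = 0"
      using pa cs unfolding c_def
      by (simp add: inner_diff inner_commute field_simps power2_eq_square)
    then have bc: "b = c *\<^sub>R a" by simp
    then have "c = 1 \<or> c = -1"
      using reduced a b unfolding reduced_rs_def by blast
    then have "c = -1" using neg pa unfolding c_def by (auto simp: field_simps)
    then show ?thesis using bc nz by simp
  qed
qed

lemma diff_root:
  assumes "a \<in> R" "b \<in> R" "a \<bullet> b > 0" "a \<noteq> b"
  shows "a - b \<in> R"
  using add_root[OF assms(1) uminus_root[OF assms(2)]] assms by simp

section \<open>Coefficients in the base, the order and positive roots\<close>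

lemma ht_add: "ht S \<alpha> (x + y) = ht S \<alpha> x + ht S \<alpha> y"
  and ht_diff: "ht S \<alpha> (x - y) = ht S \<alpha> x - ht S \<alpha> y"
  and ht_uminus: "ht S \<alpha> (- x) = - ht S \<alpha> x"
  and ht_scale: "ht S \<alpha> (r *\<^sub>R x) = r * ht S \<alpha> x"
  unfolding ht_def using indep span_S
  by (simp_all add: representation_add representation_diff representation_neg representation_scale)

lemmas ht_linear = ht_add ht_diff ht_uminus ht_scale

lemma ht_zero: "ht S \<alpha> 0 = 0"
  using ht_scale[of \<alpha> 0 0] by simp

lemma ht_simple: "\<beta> \<in> S \<Longrightarrow> ht S \<alpha> \<beta> = (if \<alpha> = \<beta> then 1 else 0)"
  unfolding ht_def using indep by (auto simp: representation_basis)

lemma ht_expansion: "(\<Sum>\<alpha>\<in>S. ht S \<alpha> x *\<^sub>R \<alpha>) = x"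
  unfolding ht_def
  using sum_representation_eq[OF indep, of x S] span_S finite_S by simp

lemma ht_sum: "finite A \<Longrightarrow> ht S \<alpha> (\<Sum>i\<in>A. f i) = (\<Sum>i\<in>A. ht S \<alpha> (f i))"
proof (induction A rule: finite_induct)
  case empty
  show ?case by (simp add: ht_zero)
qed (simp add: ht_add)

text \<open>Subsets \<open>A\<close> are allowed because later arguments truncate a vector to the
  part of its expansion supported on some of the simple roots.\<close>

lemma ht_combination:
  assumes "A \<subseteq> S" "\<alpha> \<in> S"
  shows "ht S \<alpha> (\<Sum>\<gamma>\<in>A. c \<gamma> *\<^sub>R \<gamma>) = (if \<alpha> \<in> A then c \<alpha> else 0)"
proof -
  have fin: "finite A" using assms finite_S finite_subset by blast
  have "ht S \<alpha> (\<Sum>\<gamma>\<in>A. c \<gamma> *\<^sub>R \<gamma>) = (\<Sum>\<gamma>\<in>A. if \<alpha> = \<gamma> then c \<gamma> else 0)"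
    unfolding ht_sum[OF fin] using assms(1) by (intro sum.cong) (auto simp: ht_scale ht_simple)
  then show ?thesis using fin by simp
qed

lemma inner_expansion: "x \<bullet> y = (\<Sum>\<alpha>\<in>S. ht S \<alpha> x * (\<alpha> \<bullet> y))"
  by (subst ht_expansion[of x, symmetric]) (simp only: inner_sum_left inner_scaleR_left)

lemma ht_eqI: "(\<And>\<alpha>. \<alpha> \<in> S \<Longrightarrow> ht S \<alpha> x = ht S \<alpha> y) \<Longrightarrow> x = y"
  by (subst (1 2) ht_expansion[symmetric]) simp

text \<open>Independence forces the \<open>c\<close> in the definition to be the coefficients of
  \<open>\<nu> - \<mu>\<close>, so the order can be tested one coefficient at a time.\<close>

lemma root_le_iff: "root_le S \<mu> \<nu> \<longleftrightarrow> (\<forall>\<alpha>\<in>S. ht S \<alpha> \<nu> - ht S \<alpha> \<mu> \<in> \<int> \<and> ht S \<alpha> \<mu> \<le> ht S \<alpha> \<nu>)"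
proof
  assume "root_le S \<mu> \<nu>"
  then obtain c where c: "\<forall>\<alpha>\<in>S. c \<alpha> \<in> \<int> \<and> c \<alpha> \<ge> 0" "\<nu> - \<mu> = (\<Sum>\<alpha>\<in>S. c \<alpha> *\<^sub>R \<alpha>)"
    unfolding root_le_def by auto
  then have "ht S \<alpha> \<nu> - ht S \<alpha> \<mu> = c \<alpha>" if "\<alpha> \<in> S" for \<alpha>
    using ht_combination[of S \<alpha> c] that by (metis ht_diff order_refl)
  then show "\<forall>\<alpha>\<in>S. ht S \<alpha> \<nu> - ht S \<alpha> \<mu> \<in> \<int> \<and> ht S \<alpha> \<mu> \<le> ht S \<alpha> \<nu>"
    using c(1) by (metis diff_ge_0_iff_ge)
next
  assume "\<forall>\<alpha>\<in>S. ht S \<alpha> \<nu> - ht S \<alpha> \<mu> \<in> \<int> \<and> ht S \<alpha> \<mu> \<le> ht S \<alpha> \<nu>"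
  then show "root_le S \<mu> \<nu>"
    unfolding root_le_def
    by (intro exI[of _ "\<lambda>\<alpha>. ht S \<alpha> (\<nu> - \<mu>)"]) (simp only: ht_expansion, simp add: ht_diff)
qed

lemma root_le_refl: "root_le S \<mu> \<mu>"
  by (simp add: root_le_iff)

lemma root_le_antisym: "root_le S \<mu> \<nu> \<Longrightarrow> root_le S \<nu> \<mu> \<Longrightarrow> \<mu> = \<nu>"
  by (rule ht_eqI) (simp add: root_le_iff order_antisym)

lemma root_ht:
  assumes "\<beta> \<in> R"
  shows "(\<forall>\<alpha>\<in>S. ht S \<alpha> \<beta> \<in> \<int>) \<and> ((\<forall>\<alpha>\<in>S. ht S \<alpha> \<beta> \<ge> 0) \<or> (\<forall>\<alpha>\<in>S. ht S \<alpha> \<beta> \<le> 0))"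
proof -
  have "\<exists>c. (\<forall>\<alpha>\<in>S. c \<alpha> \<in> \<int>) \<and> ((\<forall>\<alpha>\<in>S. c \<alpha> \<ge> 0) \<or> (\<forall>\<alpha>\<in>S. c \<alpha> \<le> 0)) \<and> \<beta> = (\<Sum>\<alpha>\<in>S. c \<alpha> *\<^sub>R \<alpha>)"
    using base assms unfolding is_base_def by blast
  then show ?thesis using ht_combination[OF order_refl] by force
qed

lemma ht_Ints: "\<beta> \<in> R \<Longrightarrow> \<alpha> \<in> S \<Longrightarrow> ht S \<alpha> \<beta> \<in> \<int>"
  using root_ht by blast

text \<open>The coefficients of a root never have both signs, so a single positive one
  decides.\<close>

lemma pos_rootI: "\<beta> \<in> R \<Longrightarrow> \<alpha> \<in> S \<Longrightarrow> ht S \<alpha> \<beta> > 0 \<Longrightarrow> \<beta> \<in> pos_roots R S"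
  unfolding pos_roots_def using root_ht by force

lemma pos_root_in_R: "\<beta> \<in> pos_roots R S \<Longrightarrow> \<beta> \<in> R"
  and pos_root_ht: "\<beta> \<in> pos_roots R S \<Longrightarrow> \<alpha> \<in> S \<Longrightarrow> ht S \<alpha> \<beta> \<ge> 0"
  by (auto simp: pos_roots_def)

lemma root_not_mixed:
  "\<lbrakk>\<beta> \<in> R; \<alpha> \<in> S; \<alpha>' \<in> S; ht S \<alpha> \<beta> > 0; ht S \<alpha>' \<beta> < 0\<rbrakk> \<Longrightarrow> False"
  using pos_rootI pos_root_ht by (meson not_le)

lemma simple_pos_root: "\<alpha> \<in> S \<Longrightarrow> \<alpha> \<in> pos_roots R S"
  by (rule pos_rootI[of _ \<alpha>]) (auto simp: ht_simple base_in_R)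

lemma root_pos_or_neg: "\<beta> \<in> R \<Longrightarrow> \<beta> \<in> pos_roots R S \<or> - \<beta> \<in> pos_roots R S"
  using root_ht[of \<beta>] uminus_root by (auto simp: pos_roots_def ht_uminus)

lemma pos_root_ex_ht:
  assumes "\<beta> \<in> pos_roots R S" obtains \<alpha> where "\<alpha> \<in> S" "ht S \<alpha> \<beta> > 0"
proof -
  have "\<beta> \<noteq> 0" using assms zero_notin by (auto simp: pos_roots_def)
  then have "\<exists>\<alpha>\<in>S. ht S \<alpha> \<beta> \<noteq> ht S \<alpha> 0" using ht_eqI by blast
  then show ?thesis using that pos_root_ht[OF assms] ht_zero by force
qed

text \<open>Otherwise \<open>\<alpha> - \<beta>\<close> would be a root with coefficients of both
  signs.\<close>

lemma simple_inner_le: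
  assumes "\<alpha> \<in> S" "\<beta> \<in> S" "\<alpha> \<noteq> \<beta>" shows "\<alpha> \<bullet> \<beta> \<le> 0"
proof (rule ccontr)
  assume "\<not> \<alpha> \<bullet> \<beta> \<le> 0"
  then have "\<alpha> - \<beta> \<in> R" using assms diff_root base_in_R by simp
  then show False
    using root_not_mixed[of "\<alpha> - \<beta>" \<alpha> \<beta>] assms by (simp add: ht_diff ht_simple)
qed

text \<open>The Cartan integer is negative, hence at most -1. Measured by the norm of
  \<open>\<beta>\<close>, a neighbour taken twice thus outweighs \<open>\<beta>\<close>
  itself.\<close>

lemma simple_adjacent_inner_le:
  assumes "\<alpha> \<in> S" "\<beta> \<in> S" "\<alpha> \<noteq> \<beta>" "\<alpha> \<bullet> \<beta> \<noteq> 0"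
  shows "2 * (\<alpha> \<bullet> \<beta>) \<le> - (\<beta> \<bullet> \<beta>)"
proof -
  have pos: "\<beta> \<bullet> \<beta> > 0" and neg: "\<alpha> \<bullet> \<beta> < 0"
    using assms simple_inner_le[of \<alpha> \<beta>] base_in_R root_inner_pos by force+
  obtain k :: int where k: "2 * (\<alpha> \<bullet> \<beta>) / (\<beta> \<bullet> \<beta>) = k"
    using cartan_Ints[of \<beta> \<alpha>] assms base_in_R by (auto elim!: Ints_cases)
  have "k < 0" using neg pos k by (smt (verit) divide_neg_pos of_int_0_le_iff)
  then have "real_of_int k \<le> -1" by linarith
  then have "k * (\<beta> \<bullet> \<beta>) \<le> - 1 * (\<beta> \<bullet> \<beta>)" using pos by (intro mult_right_mono) auto
  then show ?thesis using k pos by (simp add: field_simps)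
qed

text \<open>Since \<open>\<beta> \<bullet> \<beta> > 0\<close> and the coefficients are
  non-negative, some simple \<open>\<gamma>\<close> has positive product with
  \<open>\<beta>\<close>. Reducedness puts a second simple root into the support of
  \<open>\<beta>\<close>; its coefficient survives the subtraction and keeps the difference
  positive.\<close>

lemma pos_root_descend:
  assumes \<beta>: "\<beta> \<in> pos_roots R S" and ns: "\<beta> \<notin> S"
  obtains \<gamma> where "\<gamma> \<in> S" "\<beta> - \<gamma> \<in> pos_roots R S" "\<beta> \<bullet> \<gamma> > 0"
proof -
  have R: "\<beta> \<in> R" using \<beta> pos_root_in_R by simp
  have "\<exists>\<gamma>\<in>S. \<beta> \<bullet> \<gamma> > 0"
  proof (rule ccontr)
    assume "\<not> ?thesis"
    then have "(\<Sum>\<gamma>\<in>S. ht S \<gamma> \<beta> * (\<gamma> \<bullet> \<beta>)) \<le> 0"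
      using pos_root_ht[OF \<beta>] by (intro sum_nonpos mult_nonneg_nonpos) (auto simp: inner_commute not_less)
    then show False using inner_expansion[of \<beta> \<beta>] root_inner_pos[OF R] by simp
  qed
  then obtain \<gamma> where \<gamma>: "\<gamma> \<in> S" "\<beta> \<bullet> \<gamma> > 0" by auto
  have "\<exists>\<delta>\<in>S. \<delta> \<noteq> \<gamma> \<and> ht S \<delta> \<beta> \<noteq> 0"
  proof (rule ccontr)
    assume "\<not> ?thesis"
    then have eq: "\<beta> = ht S \<gamma> \<beta> *\<^sub>R \<gamma>"
      using \<gamma> by (intro ht_eqI) (auto simp: ht_scale ht_simple)
    then have "ht S \<gamma> \<beta> = 1 \<or> ht S \<gamma> \<beta> = -1"
      using reduced R base_in_R[OF \<gamma>(1)] unfolding reduced_rs_def by metis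
    then show False using eq ns \<gamma>(1) pos_root_ht[OF \<beta> \<gamma>(1)] by auto
  qed
  then obtain \<delta> where \<delta>: "\<delta> \<in> S" "\<delta> \<noteq> \<gamma>" "ht S \<delta> \<beta> > 0"
    using pos_root_ht[OF \<beta>] by force
  have "\<beta> - \<gamma> \<in> R" using diff_root[OF R base_in_R[OF \<gamma>(1)] \<gamma>(2)] ns \<gamma> by blast
  then have "\<beta> - \<gamma> \<in> pos_roots R S"
    by (rule pos_rootI[of _ \<delta>]) (use \<gamma> \<delta> in \<open>auto simp: ht_diff ht_simple\<close>)
  then show ?thesis using that \<gamma> by blast
qed

text \<open>Induction on the height, the sum of all coefficients, which the descent lowers by 1;
  \<open>nat\<close> and the floor only turn this real number into a natural one.\<close>

lemma pos_root_induct [consumes 1, case_names simple add]: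
  assumes "\<beta> \<in> pos_roots R S"
    and simple: "\<And>\<gamma>. \<gamma> \<in> S \<Longrightarrow> P \<gamma>"
    and add: "\<And>\<beta> \<gamma>. \<lbrakk>\<beta> \<in> pos_roots R S; \<gamma> \<in> S; \<beta> + \<gamma> \<in> pos_roots R S; P \<beta>\<rbrakk> \<Longrightarrow> P (\<beta> + \<gamma>)"
  shows "P \<beta>"
  using assms(1)
proof (induction "nat \<lfloor>\<Sum>\<alpha>\<in>S. ht S \<alpha> \<beta>\<rfloor>" arbitrary: \<beta> rule: less_induct)
  case less
  show ?case
  proof (cases "\<beta> \<in> S")
    case False
    then obtain \<gamma> where \<gamma>: "\<gamma> \<in> S" "\<beta> - \<gamma> \<in> pos_roots R S"
      using pos_root_descend[OF less.prems] by blast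
    have "(\<Sum>\<alpha>\<in>S. ht S \<alpha> (\<beta> - \<gamma>)) = (\<Sum>\<alpha>\<in>S. ht S \<alpha> \<beta>) - 1"
      using \<gamma>(1) finite_S by (simp add: ht_diff ht_simple sum_subtractf)
    moreover have "(\<Sum>\<alpha>\<in>S. ht S \<alpha> (\<beta> - \<gamma>)) \<ge> 0"
      by (rule sum_nonneg) (use \<gamma> pos_root_ht in blast)
    ultimately have "nat \<lfloor>\<Sum>\<alpha>\<in>S. ht S \<alpha> (\<beta> - \<gamma>)\<rfloor> < nat \<lfloor>\<Sum>\<alpha>\<in>S. ht S \<alpha> \<beta>\<rfloor>"
      by linarith
    from add[OF \<gamma>(2,1) _ less.hyps[OF this \<gamma>(2)]] show ?thesis using less.prems by simp
  qed (rule simple)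
qed

text \<open>If they were orthogonal, reflecting \<open>\<beta> + \<gamma>\<close> in
  \<open>\<gamma>\<close> would give the root \<open>\<beta> - \<gamma>\<close>, which has
  coefficient -1 at \<open>\<gamma>\<close> and a positive one elsewhere.\<close>

lemma not_orthogonal_if_add_root:
  assumes "\<beta> \<in> pos_roots R S" "\<gamma> \<in> S" "\<beta> + \<gamma> \<in> R" "ht S \<gamma> \<beta> = 0"
  shows "\<beta> \<bullet> \<gamma> \<noteq> 0"
proof
  assume orth: "\<beta> \<bullet> \<gamma> = 0"
  have "(\<beta> + \<gamma>) - (2 * ((\<beta> + \<gamma>) \<bullet> \<gamma>) / (\<gamma> \<bullet> \<gamma>)) *\<^sub>R \<gamma> = \<beta> - \<gamma>"
    using root_inner_pos[OF base_in_R[OF assms(2)]] orth by (simp add: inner_add_left scaleR_2)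
  then have "\<beta> - \<gamma> \<in> R" using reflect[OF base_in_R[OF assms(2)] assms(3)] by metis
  moreover obtain \<alpha> where "\<alpha> \<in> S" "ht S \<alpha> \<beta> > 0" using pos_root_ex_ht[OF assms(1)] .
  ultimately show False
    using root_not_mixed[of "\<beta> - \<gamma>" \<alpha> \<gamma>] assms
    by (cases "\<alpha> = \<gamma>") (auto simp: ht_diff ht_simple)
qed

text \<open>Connectedness of the Dynkin diagram. If \<open>A\<close> were orthogonal to
  \<open>S - A\<close>, a positive root built up by adding simple roots could never leave the span
  of the side where it started, and \<open>R\<close> would split into two orthogonal parts.\<close>

lemma base_connected:
  assumes irr: "irreducible_rs R" and A: "A \<subseteq> S" "A \<noteq> {}" "A \<noteq> S"
  obtains \<alpha> \<beta> where "\<alpha> \<in> A" "\<beta> \<in> S - A" "\<alpha> \<bullet> \<beta> \<noteq> 0"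
proof -
  have False if orth: "\<forall>\<alpha>\<in>A. \<forall>\<beta>\<in>S - A. \<alpha> \<bullet> \<beta> = 0"
  proof -
    define R1 R2 where "R1 = R \<inter> span A" and "R2 = R \<inter> span (S - A)"
    have orth_span: "x \<bullet> y = 0" if "x \<in> span A" "y \<in> span (S - A)" for x y
    proof -
      have "orthogonal x y'" if "y' \<in> S - A" for y'
        using orthogonal_to_span[of x A y'] \<open>x \<in> span A\<close> that orth
        by (auto simp: orthogonal_def inner_commute)
      then show ?thesis
        using orthogonal_to_span[of y "S - A" x] that(2) by (auto simp: orthogonal_def inner_commute)
    qed
    have ht_span: "ht S \<gamma> x = 0" if "x \<in> span B" "\<gamma> \<notin> B" "B \<subseteq> S" for x \<gamma> B
    proof -
      have "ht S \<gamma> x = representation B x \<gamma>"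
        unfolding ht_def using representation_extend[OF indep that(1,3)] by simp
      then show ?thesis using that(2) representation_ne_zero by metis
    qed
    have pos: "\<beta> \<in> span A \<or> \<beta> \<in> span (S - A)" if "\<beta> \<in> pos_roots R S" for \<beta>
      using that
    proof (induction rule: pos_root_induct)
      case (simple \<gamma>)
      then have "\<gamma> \<in> A \<or> \<gamma> \<in> S - A" by blast
      then show ?case using span_base by blast
    next
      case (add \<beta> \<gamma>)
      consider "\<gamma> \<in> A" "\<beta> \<in> span A" | "\<gamma> \<in> S - A" "\<beta> \<in> span (S - A)"
        | "\<gamma> \<in> A" "\<beta> \<in> span (S - A)" | "\<gamma> \<in> S - A" "\<beta> \<in> span A"
        using add by blast
      then show ?case
      proof cases
        case 3
        then have "ht S \<gamma> \<beta> = 0" "\<beta> \<bullet> \<gamma> = 0"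
          using ht_span[of \<beta> "S - A" \<gamma>] orth_span[of \<gamma> \<beta>] span_base[of \<gamma> A]
          by (auto simp: inner_commute)
        then show ?thesis using not_orthogonal_if_add_root add pos_root_in_R by blast
      next
        case 4
        then have "ht S \<gamma> \<beta> = 0" "\<beta> \<bullet> \<gamma> = 0"
          using ht_span[of \<beta> "A" \<gamma>] orth_span[of \<beta> \<gamma>] A(1) span_base[of \<gamma> "S - A"] by auto
        then show ?thesis using not_orthogonal_if_add_root add pos_root_in_R by blast
      qed (simp_all add: span_add span_clauses)
    qed
    have "R1 \<union> R2 = R"
    proof -
      have "\<beta> \<in> span A \<or> \<beta> \<in> span (S - A)" if "\<beta> \<in> R" for \<beta>
        using root_pos_or_neg[OF that] pos[of \<beta>] pos[of "- \<beta>"] span_neg[of "- \<beta>"] by auto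
      then show ?thesis unfolding R1_def R2_def by blast
    qed
    moreover have "R1 \<inter> R2 = {}"
      using orth_span zero_notin unfolding R1_def R2_def by (metis IntE disjoint_iff inner_eq_zero_iff)
    moreover have "\<forall>a\<in>R1. \<forall>b\<in>R2. a \<bullet> b = 0"
      using orth_span unfolding R1_def R2_def by auto
    moreover have "R1 \<noteq> {}" "R2 \<noteq> {}"
      using A base_subset span_superset[of A] span_superset[of "S - A"]
      unfolding R1_def R2_def by blast+
    ultimately show False using irr unfolding irreducible_rs_def by blast
  qed
  then show ?thesis using that by blast
qed

subsection \<open>Coefficients and inner products\<close>

text \<open>If the claim failed, the part \<open>p\<close> of \<open>d\<close> supported on the coefficients at least 2 and on the
  adjacent coefficients equal to 1 would satisfy \<open>p \<bullet> \<gamma> \<le> 0\<close> on its own support, hence \<open>p \<bullet> p \<le> 0\<close>.\<close>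
lemma ex_large_ht_inner_pos:
  assumes ints: "\<forall>\<gamma>\<in>S. ht S \<gamma> d \<in> \<int>" and \<gamma>0: "\<gamma>0 \<in> S" "ht S \<gamma>0 d \<ge> 2"
  obtains \<gamma> where "\<gamma> \<in> S" "ht S \<gamma> d \<ge> 2" "d \<bullet> \<gamma> > 0"
proof -
  have False if nonpos: "\<And>\<gamma>. \<gamma> \<in> S \<Longrightarrow> ht S \<gamma> d \<ge> 2 \<Longrightarrow> d \<bullet> \<gamma> \<le> 0"
  proof -
    define T where "T = {\<gamma>\<in>S. ht S \<gamma> d \<ge> 2}"
    define B where "B = {\<gamma>\<in>S. ht S \<gamma> d = 1 \<and> (\<exists>\<tau>\<in>T. \<tau> \<bullet> \<gamma> \<noteq> 0)}"
    define p where "p = (\<Sum>\<gamma>\<in>T \<union> B. ht S \<gamma> d *\<^sub>R \<gamma>)"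
    have sub: "T \<union> B \<subseteq> S" and fin: "finite (T \<union> B)"
      using finite_S unfolding T_def B_def by auto
    have ht_p: "ht S \<gamma> p = (if \<gamma> \<in> T \<union> B then ht S \<gamma> d else 0)" if "\<gamma> \<in> S" for \<gamma>
      unfolding p_def using ht_combination[OF sub that] .
    have inner_p: "p \<bullet> \<delta> = (\<Sum>\<gamma>\<in>T \<union> B. ht S \<gamma> d * (\<gamma> \<bullet> \<delta>))" for \<delta>
      unfolding p_def by (simp add: inner_sum_left)
    have "\<delta> \<bullet> p \<le> 0" if \<delta>: "\<delta> \<in> T" for \<delta>
    proof -
      \<comment> \<open>Outside the support of \<open>p\<close>, a coefficient of \<open>d\<close>
        is either at most 0, where the product with \<open>\<delta>\<close> is non-positive too, or
        equal to 1 at a simple root orthogonal to all of \<open>T\<close>. So no term is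
        negative.\<close>
      have "(d - p) \<bullet> \<delta> = (\<Sum>\<gamma>\<in>S. ht S \<gamma> (d - p) * (\<gamma> \<bullet> \<delta>))" by (rule inner_expansion)
      also have "\<dots> \<ge> 0"
      proof (rule sum_nonneg)
        fix \<gamma> assume \<gamma>: "\<gamma> \<in> S"
        obtain k :: int where k: "ht S \<gamma> d = k" using ints \<gamma> by (auto elim!: Ints_cases)
        have \<delta>S: "\<delta> \<in> S" using \<delta> unfolding T_def by simp
        consider "\<gamma> \<in> T \<union> B" | "\<gamma> \<notin> T \<union> B" "k = 1" | "\<gamma> \<notin> T \<union> B" "k \<le> 0"
          using \<gamma> k unfolding T_def by fastforce
        then show "ht S \<gamma> (d - p) * (\<gamma> \<bullet> \<delta>) \<ge> 0"
        proof cases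
          case 1
          then show ?thesis using \<gamma> by (simp add: ht_diff ht_p)
        next
          case 2
          then have "\<gamma> \<bullet> \<delta> = 0" using \<gamma> k \<delta> unfolding B_def by (auto simp: inner_commute)
          then show ?thesis by simp
        next
          case 3
          then have "\<gamma> \<bullet> \<delta> \<le> 0" using \<gamma> \<delta> \<delta>S simple_inner_le by blast
          then show ?thesis using 3 k \<gamma> by (simp add: ht_diff ht_p mult_nonpos_nonpos)
        qed
      qed
      finally have "(d - p) \<bullet> \<delta> \<ge> 0" .
      moreover have "d \<bullet> \<delta> \<le> 0" using nonpos \<delta> unfolding T_def by simp
      ultimately show ?thesis by (simp add: inner_diff_left inner_commute[of \<delta> p])
    qed
    moreover have "\<delta> \<bullet> p \<le> 0" if \<delta>: "\<delta> \<in> B" for \<delta>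
    proof -
      obtain \<tau> where \<tau>: "\<tau> \<in> T" "\<tau> \<bullet> \<delta> \<noteq> 0" using \<delta> unfolding B_def by auto
      have ne: "\<tau> \<noteq> \<delta>" and S: "\<tau> \<in> S" "\<delta> \<in> S" and ht\<tau>: "ht S \<tau> d \<ge> 2" and ht\<delta>: "ht S \<delta> d = 1"
        using \<tau> \<delta> unfolding T_def B_def by auto
      \<comment> \<open>The neighbour \<open>\<tau>\<close> alone cancels the contribution of
        \<open>\<delta>\<close> to \<open>p \<bullet> \<delta>\<close>, which is
        \<open>\<delta> \<bullet> \<delta>\<close> because the coefficient there is exactly
        1.\<close>
      have "ht S \<tau> d * (\<tau> \<bullet> \<delta>) \<le> 2 * (\<tau> \<bullet> \<delta>)"
        using simple_inner_le[OF S ne] ht\<tau> by (simp add: mult_right_mono_neg)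
      also have "\<dots> \<le> - (\<delta> \<bullet> \<delta>)" using simple_adjacent_inner_le[OF S ne \<tau>(2)] .
      finally have le: "ht S \<tau> d * (\<tau> \<bullet> \<delta>) \<le> - (\<delta> \<bullet> \<delta>)" .
      have "(\<Sum>\<gamma>\<in>T \<union> B - {\<delta>} - {\<tau>}. ht S \<gamma> d * (\<gamma> \<bullet> \<delta>)) \<le> 0"
        using simple_inner_le[OF _ S(2)]
        by (intro sum_nonpos mult_nonneg_nonpos) (auto simp: T_def B_def)
      moreover have "p \<bullet> \<delta> = ht S \<delta> d * (\<delta> \<bullet> \<delta>) + (ht S \<tau> d * (\<tau> \<bullet> \<delta>)
          + (\<Sum>\<gamma>\<in>T \<union> B - {\<delta>} - {\<tau>}. ht S \<gamma> d * (\<gamma> \<bullet> \<delta>)))"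
        using sum.remove[OF fin, of \<delta> "\<lambda>\<gamma>. ht S \<gamma> d * (\<gamma> \<bullet> \<delta>)"]
          sum.remove[of "T \<union> B - {\<delta>}" \<tau> "\<lambda>\<gamma>. ht S \<gamma> d * (\<gamma> \<bullet> \<delta>)"] fin \<delta> \<tau>(1) ne
        unfolding inner_p by simp
      ultimately show ?thesis using le ht\<delta> by (simp add: inner_commute)
    qed
    ultimately have "p \<bullet> p \<le> 0"
      unfolding inner_p[of p] by (intro sum_nonpos mult_nonneg_nonpos) (auto simp: T_def B_def)
    then have "p = 0" by (metis inner_ge_zero inner_eq_zero_iff order_antisym)
    moreover have "ht S \<gamma>0 p \<ge> 2" using ht_p[OF \<gamma>0(1)] \<gamma>0 unfolding T_def by auto
    ultimately show False using ht_zero by simp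
  qed
  then show ?thesis using that not_le by blast
qed

text \<open>Let \<open>p\<close> be the negative part of \<open>d\<close>. The supports of
  \<open>p\<close> and of the positive part \<open>d + p\<close> are disjoint, so
  \<open>p \<bullet> (d + p) \<le> 0\<close>. If the claim failed,
  \<open>p \<bullet> d \<ge> 0\<close> would follow, and then
  \<open>p \<bullet> p \<le> 0\<close>.\<close>

lemma ex_neg_ht_inner_neg:
  assumes \<gamma>0: "\<gamma>0 \<in> S" "ht S \<gamma>0 d < 0"
  obtains \<gamma> where "\<gamma> \<in> S" "ht S \<gamma> d < 0" "d \<bullet> \<gamma> < 0"
proof -
  have False if nonneg: "\<And>\<gamma>. \<gamma> \<in> S \<Longrightarrow> ht S \<gamma> d < 0 \<Longrightarrow> d \<bullet> \<gamma> \<ge> 0"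
  proof -
    define U where "U = {\<gamma>\<in>S. ht S \<gamma> d < 0}"
    define p where "p = (\<Sum>\<gamma>\<in>U. (- ht S \<gamma> d) *\<^sub>R \<gamma>)"
    have US: "U \<subseteq> S" unfolding U_def by auto
    have ht_p: "ht S \<gamma> p = (if \<gamma> \<in> U then - ht S \<gamma> d else 0)" if "\<gamma> \<in> S" for \<gamma>
      unfolding p_def using ht_combination[OF US that] .
    have inner_p: "p \<bullet> x = (\<Sum>\<gamma>\<in>U. - ht S \<gamma> d * (\<gamma> \<bullet> x))" for x
      unfolding p_def by (simp add: inner_sum_left)
    have "p \<bullet> d \<ge> 0"
      unfolding inner_p by (intro sum_nonneg mult_nonneg_nonneg) (auto simp: U_def inner_commute[of _ d] nonneg)
    moreover have "p \<bullet> (d + p) \<le> 0"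
      unfolding inner_p
    proof (intro sum_nonpos mult_nonneg_nonpos)
      fix \<gamma> assume \<gamma>: "\<gamma> \<in> U"
      then show "- ht S \<gamma> d \<ge> 0" unfolding U_def by simp
      have "(d + p) \<bullet> \<gamma> = (\<Sum>\<delta>\<in>S. ht S \<delta> (d + p) * (\<delta> \<bullet> \<gamma>))" by (rule inner_expansion)
      also have "\<dots> \<le> 0"
      proof (rule sum_nonpos)
        fix \<delta> assume \<delta>: "\<delta> \<in> S"
        show "ht S \<delta> (d + p) * (\<delta> \<bullet> \<gamma>) \<le> 0"
        proof (cases "\<delta> \<in> U")
          case True
          then show ?thesis using \<delta> by (simp add: ht_add ht_p)
        next
          case False
          then have "\<delta> \<bullet> \<gamma> \<le> 0" "ht S \<delta> d \<ge> 0"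
            using \<gamma> \<delta> US simple_inner_le[of \<delta> \<gamma>] unfolding U_def by auto
          then show ?thesis using False \<delta> by (simp add: ht_add ht_p mult_nonneg_nonpos)
        qed
      qed
      finally show "\<gamma> \<bullet> (d + p) \<le> 0" by (simp add: inner_commute)
    qed
    ultimately have "p \<bullet> p \<le> 0" by (simp add: inner_add_right)
    then have "p = 0" by (metis inner_ge_zero inner_eq_zero_iff order_antisym)
    moreover have "ht S \<gamma>0 p > 0" using ht_p[OF \<gamma>0(1)] \<gamma>0 unfolding U_def by auto
    ultimately show False using ht_zero by simp
  qed
  then show ?thesis using that not_le by blast
qed

subsection \<open>Recognising type A\<close>

text \<open>In the doubled product \<open>c\<close> contributes \<open>2 * (c \<bullet> c)\<close>,
  each neighbour in \<open>N\<close> at most \<open>- (c \<bullet> c)\<close>, and every other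
  simple root at most 0. A lower bound on the left therefore limits the number of
  neighbours.\<close>

lemma inner_simple_le:
  assumes c: "c \<in> S" and N: "N \<subseteq> S - {c}" "\<forall>\<gamma>\<in>N. \<gamma> \<bullet> c \<noteq> 0"
  shows "2 * ((\<Sum>\<gamma>\<in>S. \<gamma>) \<bullet> c) \<le> (2 - real (card N)) * (c \<bullet> c)"
proof -
  have fin: "finite N" "finite (S - {c})" using N(1) finite_S finite_subset by auto
  have "(\<Sum>\<gamma>\<in>S - {c}. 2 * (\<gamma> \<bullet> c)) = (\<Sum>\<gamma>\<in>S - {c} - N. 2 * (\<gamma> \<bullet> c)) + (\<Sum>\<gamma>\<in>N. 2 * (\<gamma> \<bullet> c))"
    using sum.subset_diff[OF N(1) fin(2)] .
  also have "(\<Sum>\<gamma>\<in>S - {c} - N. 2 * (\<gamma> \<bullet> c)) \<le> 0"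
    using c simple_inner_le by (intro sum_nonpos) auto
  also have "(\<Sum>\<gamma>\<in>N. 2 * (\<gamma> \<bullet> c)) \<le> (\<Sum>\<gamma>\<in>N. - (c \<bullet> c))"
    using c N by (intro sum_mono simple_adjacent_inner_le) auto
  finally have "(\<Sum>\<gamma>\<in>S - {c}. 2 * (\<gamma> \<bullet> c)) \<le> - (card N * (c \<bullet> c))" by simp
  moreover have "2 * ((\<Sum>\<gamma>\<in>S. \<gamma>) \<bullet> c) = 2 * (c \<bullet> c) + (\<Sum>\<gamma>\<in>S - {c}. 2 * (\<gamma> \<bullet> c))"
    using sum.remove[OF finite_S c, of "\<lambda>\<gamma>. \<gamma> \<bullet> c"]
    by (simp add: inner_sum_left sum_distrib_left[symmetric])
  ultimately show ?thesis by (simp add: algebra_simps)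
qed

text \<open>A simple root with three neighbours, or one
  with two neighbours that is not orthogonal to \<open>\<Sum>S\<close>, would violate dominance; so the Dynkin
  diagram is a path starting at \<open>a0\<close>.\<close>
lemma ex_path_enumeration:
  assumes irr: "irreducible_rs R"
    and dominant: "\<forall>\<gamma>\<in>S. (\<Sum>S) \<bullet> \<gamma> \<ge> 0"
    and start: "a0 \<in> S" "(\<Sum>S) \<bullet> a0 > 0"
  obtains a where "bij_betw a {..<card S} S"
    and "\<And>k. Suc k < card S \<Longrightarrow> a k \<bullet> a (Suc k) \<noteq> 0"
    and "\<And>j k. Suc j < k \<Longrightarrow> k < card S \<Longrightarrow> a j \<bullet> a k = 0"
proof -
  \<comment> \<open>The last clause closes every vertex but the final one: its neighbours lie on the
    path, no later than the next vertex. Only the final vertex may have others.\<close>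
  define Path where "Path i a \<longleftrightarrow> inj_on a {..<i} \<and> a ` {..<i} \<subseteq> S \<and> a 0 = a0 \<and>
      (\<forall>k. Suc k < i \<longrightarrow> a k \<bullet> a (Suc k) \<noteq> 0) \<and>
      (\<forall>k. Suc k < i \<longrightarrow> (\<forall>\<gamma>\<in>S. a k \<bullet> \<gamma> \<noteq> 0 \<longrightarrow> \<gamma> \<in> a ` {..Suc k}))" for i a
  have "\<exists>a. Path i a" if "1 \<le> i" "i \<le> card S" for i
    using that
  proof (induction i rule: dec_induct)
    case base
    show ?case unfolding Path_def using start by (intro exI[of _ "\<lambda>_. a0"]) (auto simp: inj_on_def)
  next
    case (step i)
    then obtain a where "Path i a" by auto
    then have inj: "inj_on a {..<i}" and im: "a ` {..<i} \<subseteq> S" and a_0: "a 0 = a0"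
      and adj: "\<And>k. Suc k < i \<Longrightarrow> a k \<bullet> a (Suc k) \<noteq> 0"
      and closed: "\<And>k \<gamma>. Suc k < i \<Longrightarrow> \<gamma> \<in> S \<Longrightarrow> a k \<bullet> \<gamma> \<noteq> 0 \<Longrightarrow> \<gamma> \<in> a ` {..Suc k}"
      unfolding Path_def by blast+
    obtain l where l: "i = Suc l" using step.hyps by (cases i) auto
    have "card (a ` {..<i}) = i" using card_image[OF inj] by simp
    then have proper: "a ` {..<i} \<noteq> S" using step.prems by (metis Suc_n_not_le_n)
    have "a ` {..<i} \<noteq> {}" using l by blast
    \<comment> \<open>Connectedness gives an edge leaving the path; since the earlier vertices are
      closed, it can only start at the end \<open>a l\<close>.\<close>
    then obtain \<alpha> \<beta> where "\<alpha> \<in> a ` {..<i}" and "\<beta> \<in> S - a ` {..<i}" and "\<alpha> \<bullet> \<beta> \<noteq> 0"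
      by (rule base_connected[OF irr im _ proper])
    then have \<beta>: "\<beta> \<in> S" "\<beta> \<notin> a ` {..<i}" and "\<exists>k<i. a k \<bullet> \<beta> \<noteq> 0" by auto
    then obtain k where k: "k < i" "a k \<bullet> \<beta> \<noteq> 0" by auto
    have "\<not> Suc k < i"
    proof
      assume ki: "Suc k < i"
      then have "{..Suc k} \<subseteq> {..<i}" by auto
      moreover have "\<beta> \<in> a ` {..Suc k}" using closed[OF ki \<beta>(1) k(2)] .
      ultimately show False using \<beta>(2) by blast
    qed
    then have "k = l" using k(1) l by linarith
    then have al\<beta>: "a l \<bullet> \<beta> \<noteq> 0" using k(2) by simp
    have al: "a l \<in> S" using im l by auto
    define a' where "a' = a(i := \<beta>)"
    have a'_eq: "a' k = a k" if "k < i" for k using that unfolding a'_def by simp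
    have a'_i: "a' i = \<beta>" unfolding a'_def by simp
    have a'_im: "a' ` {..<i} = a ` {..<i}" using a'_eq by (intro image_cong) auto
    \<comment> \<open>A second new neighbour \<open>\<gamma>\<close> would give \<open>a l\<close>
      two neighbours if it is the start, against \<open>\<Sum>S \<bullet> a0 > 0\<close>, and three
      otherwise, against dominance.\<close>
    have last: "\<gamma> \<in> a' ` {..i}" if \<gamma>: "\<gamma> \<in> S" "a l \<bullet> \<gamma> \<noteq> 0" for \<gamma>
    proof (rule ccontr)
      assume "\<gamma> \<notin> a' ` {..i}"
      moreover have "a' ` {..i} = insert \<beta> (a ` {..<i})"
        using a'_im by (simp add: a'_i lessThan_Suc_atMost[symmetric] lessThan_Suc)
      ultimately have new: "\<gamma> \<notin> a ` {..<i}" "\<gamma> \<noteq> \<beta>" by auto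
      show False
      proof (cases l)
        case 0
        have "2 * (\<Sum>S \<bullet> a l) \<le> (2 - real (card {\<beta>, \<gamma>})) * (a l \<bullet> a l)"
          using al \<beta> \<gamma> new al\<beta> l by (intro inner_simple_le) (auto simp: inner_commute)
        then show False using new(2) 0 a_0 start(2) by (simp add: card_insert_if)
      next
        case (Suc m)
        then have ne: "a m \<noteq> a l" using inj l by (auto dest: inj_onD[of _ _ m l])
        have am: "a m \<in> a ` {..<i}" using l Suc by auto
        have "2 * (\<Sum>S \<bullet> a l) \<le> (2 - real (card {\<beta>, \<gamma>, a m})) * (a l \<bullet> a l)"
          using al \<beta> \<gamma> new al\<beta> l ne am im adj[of m] Suc
          by (intro inner_simple_le) (auto simp: inner_commute)
        moreover have "card {\<beta>, \<gamma>, a m} = 3" using new \<beta> am by (auto simp: card_insert_if)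
        ultimately have "2 * (\<Sum>S \<bullet> a l) \<le> - (a l \<bullet> a l)" by simp
        moreover have "\<Sum>S \<bullet> a l \<ge> 0" using dominant al by blast
        ultimately show False using root_inner_pos[OF base_in_R[OF al]] by linarith
      qed
    qed
    have "Path (Suc i) a'"
      unfolding Path_def
    proof (intro conjI allI impI ballI)
      have "inj_on a' {..<i}" using inj a'_eq by (auto simp: inj_on_def)
      then show "inj_on a' {..<Suc i}"
        using \<beta>(2) a'_im unfolding lessThan_Suc by (simp add: a'_i)
      show "a' ` {..<Suc i} \<subseteq> S" using a'_im im \<beta> unfolding lessThan_Suc by (simp add: a'_i)
      show "a' 0 = a0" using a_0 l by (simp add: a'_def)
    next
      fix k assume "Suc k < Suc i"
      then show "a' k \<bullet> a' (Suc k) \<noteq> 0"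
        using adj[of k] al\<beta> l unfolding a'_def by (cases "k = l") auto
    next
      fix k \<gamma> assume k: "Suc k < Suc i" and \<gamma>: "\<gamma> \<in> S" "a' k \<bullet> \<gamma> \<noteq> 0"
      show "\<gamma> \<in> a' ` {..Suc k}"
      proof (cases "k = l")
        case True
        then show ?thesis using last \<gamma> a'_eq l by simp
      next
        case False
        then have "Suc k < i" using k l by simp
        moreover from this have "a' ` {..Suc k} = a ` {..Suc k}" using a'_eq by (intro image_cong) auto
        ultimately show ?thesis using closed \<gamma> a'_eq by simp
      qed
    qed
    then show ?case by blast
  qed
  moreover have "card S \<ge> 1" using start finite_S by (metis One_nat_def Suc_leI card_gt_0_iff empty_iff)
  ultimately obtain a where a: "Path (card S) a" by blast
  show ?thesis
  proof (rule that[of a])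
    have "card (a ` {..<card S}) = card S" using a card_image unfolding Path_def by fastforce
    then show "bij_betw a {..<card S} S"
      using a card_subset_eq[OF finite_S] unfolding Path_def bij_betw_def by blast
    show "a k \<bullet> a (Suc k) \<noteq> 0" if "Suc k < card S" for k
      using a that unfolding Path_def by blast
    show "a j \<bullet> a k = 0" if jk: "Suc j < k" "k < card S" for j k
    proof (rule ccontr)
      assume "a j \<bullet> a k \<noteq> 0"
      moreover have "a k \<in> S" using a jk unfolding Path_def by blast
      ultimately have "a k \<in> a ` {..Suc j}" using a jk unfolding Path_def by simp
      then obtain m where m: "m \<le> Suc j" "a k = a m" by auto
      have "inj_on a {..<card S}" using a unfolding Path_def by blast
      from inj_onD[OF this m(2)] show False using m(1) jk by simp
    qed
  qed
qed

text \<open>With \<open>v i\<close> the sum of the first \<open>i\<close> simple roots of the path,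
  the positive roots are exactly the interval sums \<open>v i - v j\<close> for
  \<open>j < i\<close>.\<close>

lemma type_A_of_path:
  assumes bij: "bij_betw a {..<n} S" and n: "n \<ge> 1"
    and adj: "\<And>k. Suc k < n \<Longrightarrow> a k \<bullet> a (Suc k) \<noteq> 0"
    and orth: "\<And>j k. Suc j < k \<Longrightarrow> k < n \<Longrightarrow> a j \<bullet> a k = 0"
    and ht_le1: "\<And>\<beta> \<gamma>. \<beta> \<in> pos_roots R S \<Longrightarrow> \<gamma> \<in> S \<Longrightarrow> ht S \<gamma> \<beta> \<le> 1"
  shows "type_A R"
proof -
  have aS: "a k \<in> S" if "k < n" for k using bij that by (auto simp: bij_betw_def)
  have a_eq: "a j = a k \<longleftrightarrow> j = k" if "j < n" "k < n" for j k
    using bij that by (auto simp: bij_betw_def inj_on_def)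
  define v where "v i = (\<Sum>k<i. a k)" for i
  have v_Suc: "v (Suc i) = v i + a i" for i unfolding v_def by simp
  have v_diff: "v i - v j = (\<Sum>k\<in>{j..<i}. a k)" if "j \<le> i" for i j
    using sum_diff_nat_ivl[of 0 j i a] that unfolding v_def by (simp add: atLeast0LessThan)
  have ht_v: "ht S (a k) (v i) = (if k < i then 1 else 0)" if "k < n" "i \<le> n" for i k
  proof -
    have "ht S (a k) (v i) = (\<Sum>j<i. if j = k then 1 else 0)"
      unfolding v_def using that by (subst ht_sum) (auto simp: ht_simple aS a_eq intro!: sum.cong)
    then show ?thesis by simp
  qed
  have v_ne: "v i \<noteq> v j" if "j < i" "i \<le> n" for i j
    using ht_v[of j i] ht_v[of j j] that by auto
  have inj: "inj_on v {0..n}"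
    by (rule linorder_inj_onI) (auto dest: v_ne)
  have up: "v i - v j \<in> R" if "j < i" "i \<le> n" for i j
    using Suc_leI[OF that(1)] that(2)
  proof (induction i rule: dec_induct)
    case base
    then show ?case using base_in_R[OF aS] by (simp add: v_Suc)
  next
    case (step i)
    obtain l where l: "i = Suc l" "j \<le> l" using step.hyps by (cases i) auto
    \<comment> \<open>No summand of \<open>v i - v j\<close> has positive product with
      \<open>a i\<close>, and the last one, \<open>a l\<close>, has a negative product, so
      \<open>a i\<close> can be added.\<close>
    have "(\<Sum>k\<in>{j..<l}. a k \<bullet> a i) \<le> 0"
      using step.prems l simple_inner_le aS a_eq by (intro sum_nonpos) simp
    moreover have "a l \<bullet> a i < 0"
      using step.prems l adj[of l] simple_inner_le[of "a l" "a i"] aS a_eq by (simp add: less_le)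
    ultimately have "(v i - v j) \<bullet> a i < 0"
      using l by (simp add: v_diff inner_add_left inner_sum_left)
    moreover have "v i - v j + a i \<noteq> 0" using v_ne[of j "Suc i"] step by (auto simp: v_Suc algebra_simps)
    ultimately have "v i - v j + a i \<in> R" using add_root step base_in_R[OF aS] by simp
    then show ?case by (simp add: v_Suc algebra_simps)
  qed
  have down: "\<exists>i j. j < i \<and> i \<le> n \<and> \<beta> = v i - v j" if "\<beta> \<in> pos_roots R S" for \<beta>
    using that
  proof (induction rule: pos_root_induct)
    case (simple \<gamma>)
    then obtain k where "k < n" "\<gamma> = a k" using bij by (auto simp: bij_betw_def)
    then show ?case by (intro exI[of _ "Suc k"] exI[of _ k]) (simp add: v_Suc)
  next
    case (add \<beta> \<gamma>)
    obtain i j where ij: "j < i" "i \<le> n" and \<beta>: "\<beta> = v i - v j" using add.IH by blast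
    obtain k where k: "k < n" "\<gamma> = a k" using bij add.hyps by (auto simp: bij_betw_def)
    have ht\<beta>: "ht S \<gamma> \<beta> = (if j \<le> k \<and> k < i then 1 else 0)"
      unfolding \<beta> k(2) ht_diff using ij k(1) by (auto simp: ht_v)
    \<comment> \<open>Coefficients are bounded by 1, so the added simple root lies outside the
      interval of \<open>\<beta>\<close>.\<close>
    have "ht S \<gamma> \<beta> + 1 \<le> 1"
      using ht_le1[OF add.hyps(3,2)] add.hyps(2) by (simp add: ht_add ht_simple)
    then have out: "k < j \<or> i \<le> k" and "ht S \<gamma> \<beta> = 0"
      using ht\<beta> by (auto split: if_splits)
    then have "\<beta> \<bullet> \<gamma> \<noteq> 0" using not_orthogonal_if_add_root add.hyps pos_root_in_R by blast
    moreover have "\<beta> \<bullet> \<gamma> = (\<Sum>l\<in>{j..<i}. a l \<bullet> a k)"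
      unfolding \<beta> k(2) using ij by (simp add: v_diff inner_sum_left)
    ultimately obtain l where l: "j \<le> l" "l < i" "a l \<bullet> a k \<noteq> 0"
      by (metis (no_types, lifting) sum.neutral atLeastLessThan_iff)
    \<comment> \<open>Being adjacent to a member of the interval but outside it, \<open>a k\<close>
      extends the interval at one of its two ends.\<close>
    have "\<not> Suc l < k" "\<not> Suc k < l" using l orth[of l k] orth[of k l] k ij by (auto simp: inner_commute)
    then have "k = i \<or> Suc k = j" using out l by linarith
    then show ?case
    proof
      assume "k = i"
      then have "\<beta> + \<gamma> = v (Suc i) - v j" using \<beta> k by (simp add: v_Suc)
      then show ?thesis using \<open>k = i\<close> k ij by (intro exI[of _ "Suc i"] exI[of _ j]) simp
    next
      assume "Suc k = j"
      then have "\<beta> + \<gamma> = v i - v k" using \<beta> k by (auto simp: v_Suc)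
      then show ?thesis using \<open>Suc k = j\<close> ij by (intro exI[of _ i] exI[of _ k]) simp
    qed
  qed
  have "R = {v i - v j | i j. i \<le> n \<and> j \<le> n \<and> i \<noteq> j}"
  proof (intro equalityI subsetI)
    fix \<beta> assume "\<beta> \<in> R"
    then consider "\<beta> \<in> pos_roots R S" | "- \<beta> \<in> pos_roots R S" using root_pos_or_neg by blast
    then show "\<beta> \<in> {v i - v j | i j. i \<le> n \<and> j \<le> n \<and> i \<noteq> j}"
    proof cases
      case 1
      then show ?thesis using down by fastforce
    next
      case 2
      then obtain i j where "j < i" "i \<le> n" "\<beta> = v j - v i"
        using down by (metis minus_diff_eq minus_minus)
      then show ?thesis by fastforce
    qed
  next
    fix \<beta> assume "\<beta> \<in> {v i - v j | i j. i \<le> n \<and> j \<le> n \<and> i \<noteq> j}"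
    then obtain i j where ij: "i \<le> n" "j \<le> n" "i \<noteq> j" "\<beta> = v i - v j" by blast
    then show "\<beta> \<in> R"
      using up[of j i] uminus_root[OF up[of i j]] by (cases "j < i") auto
  qed
  \<comment> \<open>Since \<open>v 0 = 0\<close>, linear independence of the other points suffices;
    these at most \<open>n\<close> vectors span a space of dimension \<open>n\<close>.\<close>
  moreover have "\<not> affine_dependent (v ` {0..n})"
  proof -
    have "a k \<in> span (v ` {1..n})" if "k < n" for k
    proof -
      have "v i \<in> span (v ` {1..n})" if "i \<le> n" for i
        using that by (cases "i = 0") (auto simp: v_def span_zero intro!: span_base)
      then have "v (Suc k) - v k \<in> span (v ` {1..n})" using \<open>k < n\<close> by (intro span_diff) auto
      then show ?thesis by (simp add: v_Suc)
    qed
    then have "S \<subseteq> span (v ` {1..n})" using bij by (auto simp: bij_betw_def)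
    then have "span (v ` {1..n}) = UNIV" using span_minimal[OF _ subspace_span] span_S by blast
    moreover have "card (v ` {1..n}) \<le> dim (UNIV :: 'a set)"
      using card_image_le[of "{1..n}" v] bij_betw_same_card[OF bij] dim_span_eq_card_independent[OF indep]
      by (simp add: span_S)
    ultimately have "independent (v ` {1..n})"
      using card_le_dim_spanning[of "v ` {1..n}" UNIV] by simp
    moreover have "v ` {0..n} = insert 0 (v ` {1..n})"
    proof -
      have "{0..n} = insert 0 {1..n}" by auto
      then show ?thesis by (simp add: v_def)
    qed
    moreover have "0 \<notin> v ` {1..n}"
    proof
      assume "0 \<in> v ` {1..n}"
      then obtain i where "1 \<le> i" "i \<le> n" "v i = v 0" by (auto simp: v_def)
      then show False using v_ne[of 0 i] by simp
    qed
    ultimately show ?thesis using affine_dependent_iff_dependent[of 0 "v ` {1..n}"] by simp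
  qed
  ultimately show ?thesis unfolding type_A_def using inj n by (intro exI[of _ n] exI[of _ v] conjI)
qed

end

subsection \<open>The highest root\<close>

locale highest_root_system = based_root_system R S for R S :: "'a::euclidean_space set" +
  fixes \<theta> :: 'a
  assumes irreducible: "irreducible_rs R"
    and theta_pos: "\<theta> \<in> pos_roots R S"
    and theta_highest: "\<And>\<beta>. \<beta> \<in> pos_roots R S \<Longrightarrow> root_le S \<beta> \<theta>"
begin

lemma theta_root: "\<theta> \<in> R"
  using theta_pos pos_root_in_R by simp

lemma ht_le_theta: "\<beta> \<in> pos_roots R S \<Longrightarrow> \<alpha> \<in> S \<Longrightarrow> ht S \<alpha> \<beta> \<le> ht S \<alpha> \<theta>"
  using theta_highest root_le_iff by blast

lemma ht_theta_ge_1: "\<alpha> \<in> S \<Longrightarrow> ht S \<alpha> \<theta> \<ge> 1"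
  using ht_le_theta[OF simple_pos_root] by (force simp: ht_simple)

lemma ht_theta_ge_2: "\<alpha> \<in> S \<Longrightarrow> ht S \<alpha> \<theta> \<noteq> 1 \<Longrightarrow> ht S \<alpha> \<theta> \<ge> 2"
  using ht_theta_ge_1[of \<alpha>] ht_Ints[OF theta_root, of \<alpha>] by (auto elim!: Ints_cases)

text \<open>Otherwise \<open>\<theta> + \<alpha>\<close> would be a root above the highest
  one.\<close>

lemma theta_inner_nonneg:
  assumes "\<alpha> \<in> S" shows "\<theta> \<bullet> \<alpha> \<ge> 0"
proof (rule ccontr)
  assume neg: "\<not> \<theta> \<bullet> \<alpha> \<ge> 0"
  have ht: "ht S \<alpha> (\<theta> + \<alpha>) = ht S \<alpha> \<theta> + 1" using assms by (simp add: ht_add ht_simple)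
  then have pos: "ht S \<alpha> (\<theta> + \<alpha>) > 0" using ht_theta_ge_1[OF assms] by simp
  then have "\<theta> + \<alpha> \<noteq> 0" using ht_zero by auto
  then have "\<theta> + \<alpha> \<in> pos_roots R S"
    using add_root[OF theta_root base_in_R[OF assms]] neg pos pos_rootI[OF _ assms] by simp
  then show False using ht_le_theta[OF _ assms] ht by fastforce
qed

text \<open>Any coefficient at least 2 would yield one at a simple root with positive product with
  \<open>\<theta>\<close>. Hence \<open>\<theta> = \<Sum>S\<close>; its dominance makes the diagram
  a path, and all coefficients of positive roots are at most 1.\<close>

lemma type_A_if_coefficients_1:
  assumes "\<forall>\<gamma>\<in>S. \<theta> \<bullet> \<gamma> \<noteq> 0 \<longrightarrow> ht S \<gamma> \<theta> = 1"
  shows "type_A R"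
proof -
  have ht1: "ht S \<gamma> \<theta> = 1" if \<gamma>: "\<gamma> \<in> S" for \<gamma>
  proof (rule ccontr)
    assume "ht S \<gamma> \<theta> \<noteq> 1"
    then have "ht S \<gamma> \<theta> \<ge> 2" using ht_theta_ge_2 \<gamma> by blast
    moreover have "\<forall>\<gamma>\<in>S. ht S \<gamma> \<theta> \<in> \<int>" using ht_Ints[OF theta_root] by blast
    ultimately obtain \<delta> where "\<delta> \<in> S" "ht S \<delta> \<theta> \<ge> 2" "\<theta> \<bullet> \<delta> > 0"
      using ex_large_ht_inner_pos[of \<theta> \<gamma>] \<gamma> by blast
    then show False using assms by force
  qed
  have theta: "\<theta> = \<Sum>S" using ht_expansion[of \<theta>] ht1 by simp
  have "\<exists>a0\<in>S. \<theta> \<bullet> a0 > 0"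
  proof (rule ccontr)
    assume "\<not> ?thesis"
    then have "(\<Sum>\<alpha>\<in>S. ht S \<alpha> \<theta> * (\<alpha> \<bullet> \<theta>)) \<le> 0"
      using ht1 by (intro sum_nonpos) (auto simp: inner_commute not_less)
    then show False using inner_expansion[of \<theta> \<theta>] root_inner_pos[OF theta_root] by simp
  qed
  then obtain a0 where a0: "a0 \<in> S" "\<theta> \<bullet> a0 > 0" by blast
  then have n: "card S \<ge> 1" using finite_S by (metis One_nat_def Suc_leI card_gt_0_iff empty_iff)
  have dominant: "\<forall>\<gamma>\<in>S. \<Sum>S \<bullet> \<gamma> \<ge> 0" and start: "\<Sum>S \<bullet> a0 > 0"
    using theta_inner_nonneg a0(2) unfolding theta by simp_all
  have ht_le1: "ht S \<gamma> \<beta> \<le> 1" if "\<beta> \<in> pos_roots R S" "\<gamma> \<in> S" for \<beta> \<gamma>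
    using ht_le_theta[OF that] ht1[OF that(2)] by simp
  show ?thesis
    by (rule ex_path_enumeration[OF irreducible dominant a0(1) start])
      (rule type_A_of_path[OF _ n _ _ ht_le1])
qed

text \<open>Outside type A the extended Dynkin diagram has a single edge at the affine node: in
  \<open>2 = (\<Sum>\<alpha>\<in>S. ht S \<alpha> \<theta> * (2 * (\<alpha> \<bullet> \<theta>) / (\<theta> \<bullet> \<theta>)))\<close> one term already exhausts the sum.\<close>
lemma ex_unique_nonorthogonal_simple:
  assumes "\<not> type_A R"
  obtains \<alpha>0 where "\<alpha>0 \<in> S" "ht S \<alpha>0 \<theta> = 2" "2 * (\<alpha>0 \<bullet> \<theta>) = \<theta> \<bullet> \<theta>"
    and "\<And>\<gamma>. \<gamma> \<in> S \<Longrightarrow> \<gamma> \<noteq> \<alpha>0 \<Longrightarrow> \<gamma> \<bullet> \<theta> = 0"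
proof -
  obtain \<alpha>0 where \<alpha>0: "\<alpha>0 \<in> S" "\<theta> \<bullet> \<alpha>0 \<noteq> 0" "ht S \<alpha>0 \<theta> \<ge> 2"
    using type_A_if_coefficients_1 assms ht_theta_ge_2 by blast
  define N where "N = \<theta> \<bullet> \<theta>"
  have N: "N > 0" using root_inner_pos[OF theta_root] unfolding N_def by simp
  \<comment> \<open>For roots \<open>\<alpha>\<close> these are the Cartan integers with respect to
    \<open>\<theta>\<close>.\<close>
  define k where "k \<alpha> = 2 * (\<alpha> \<bullet> \<theta>) / N" for \<alpha>
  have inner_k: "2 * (\<alpha> \<bullet> \<theta>) = k \<alpha> * N" for \<alpha> using N unfolding k_def by simp
  have k_nonneg: "k \<alpha> \<ge> 0" if "\<alpha> \<in> S" for \<alpha>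
    using theta_inner_nonneg[OF that] N unfolding k_def by (simp add: inner_commute)
  have "k \<alpha>0 \<in> \<int>" using cartan_Ints[OF theta_root base_in_R[OF \<alpha>0(1)]] unfolding k_def N_def .
  moreover have "k \<alpha>0 \<noteq> 0" using \<alpha>0(2) N unfolding k_def by (simp add: inner_commute)
  ultimately have k1: "k \<alpha>0 \<ge> 1" using k_nonneg[OF \<alpha>0(1)] by (auto elim!: Ints_cases)
  have "(\<Sum>\<alpha>\<in>S. ht S \<alpha> \<theta> * k \<alpha>) * N = 2 * (\<Sum>\<alpha>\<in>S. ht S \<alpha> \<theta> * (\<alpha> \<bullet> \<theta>))"
    by (simp add: sum_distrib_right sum_distrib_left mult.assoc inner_k[symmetric] mult.left_commute)
  also have "\<dots> = 2 * N" by (simp only: inner_expansion[symmetric] N_def)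
  finally have "(\<Sum>\<alpha>\<in>S. ht S \<alpha> \<theta> * k \<alpha>) = 2" using N by simp
  then have split: "ht S \<alpha>0 \<theta> * k \<alpha>0 + (\<Sum>\<alpha>\<in>S - {\<alpha>0}. ht S \<alpha> \<theta> * k \<alpha>) = 2"
    using sum.remove[OF finite_S \<alpha>0(1), of "\<lambda>\<alpha>. ht S \<alpha> \<theta> * k \<alpha>"] by simp
  have term_nonneg: "ht S \<alpha> \<theta> * k \<alpha> \<ge> 0" if "\<alpha> \<in> S" for \<alpha>
    using pos_root_ht[OF theta_pos that] k_nonneg[OF that] by simp
  then have rest: "(\<Sum>\<alpha>\<in>S - {\<alpha>0}. ht S \<alpha> \<theta> * k \<alpha>) \<ge> 0" by (intro sum_nonneg) auto
  \<comment> \<open>The \<open>\<alpha>0\<close> term is at most 2, while its factors are at least 2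
    and 1; so both bounds are attained and the rest of the sum vanishes.\<close>
  have "2 * k \<alpha>0 \<le> ht S \<alpha>0 \<theta> * k \<alpha>0" "ht S \<alpha>0 \<theta> * 1 \<le> ht S \<alpha>0 \<theta> * k \<alpha>0"
    using \<alpha>0(3) k1 by (auto intro: mult_right_mono mult_left_mono)
  then have eqs: "ht S \<alpha>0 \<theta> = 2" "k \<alpha>0 = 1" and "(\<Sum>\<alpha>\<in>S - {\<alpha>0}. ht S \<alpha> \<theta> * k \<alpha>) = 0"
    using split rest \<alpha>0(3) k1 by linarith+
  then have "\<forall>\<alpha>\<in>S - {\<alpha>0}. ht S \<alpha> \<theta> * k \<alpha> = 0"
    using term_nonneg finite_S by (subst (asm) sum_nonneg_eq_0_iff) auto
  then have "\<gamma> \<bullet> \<theta> = 0" if "\<gamma> \<in> S" "\<gamma> \<noteq> \<alpha>0" for \<gamma>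
    using that ht_theta_ge_1[OF that(1)] inner_k[of \<gamma>] by force
  then show ?thesis using that \<alpha>0(1) eqs inner_k[of \<alpha>0] unfolding N_def by simp
qed

text \<open>Instead of iterating the moves, a root \<open>\<eta>\<close> minimising the total
  distance \<open>\<Phi>\<close> is chosen; a possible move would contradict minimality.\<close>

lemma half_floor_root:
  assumes \<alpha>0: "\<alpha>0 \<in> S" "ht S \<alpha>0 \<theta> = 2"
    and orth: "\<And>\<gamma>. \<gamma> \<in> S \<Longrightarrow> \<gamma> \<noteq> \<alpha>0 \<Longrightarrow> \<gamma> \<bullet> \<theta> = 0"
  shows "half_floor S \<theta> \<in> R"
proof -
  define X where "X = {\<eta>\<in>R. ht S \<alpha>0 \<eta> = 1}"
  \<comment> \<open>An integer is nearest to 1/2 exactly when it is 0 or 1. From any other integer,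
    a shift by 2 towards 1/2 strictly reduces the distance.\<close>
  define \<Phi> where "\<Phi> \<eta> = (\<Sum>\<gamma>\<in>S. \<bar>ht S \<gamma> \<theta> - 2 * ht S \<gamma> \<eta> - 1/2\<bar>)" for \<eta>
  have "finite X" "X \<noteq> {}"
    using finite_R base_in_R[OF \<alpha>0(1)] \<alpha>0(1) unfolding X_def by (auto simp: ht_simple)
  then obtain \<eta> where "\<eta> \<in> X" and min: "\<And>\<eta>'. \<eta>' \<in> X \<Longrightarrow> \<Phi> \<eta> \<le> \<Phi> \<eta>'"
    using ex_is_arg_min_if_finite[of X \<Phi>] unfolding is_arg_min_linorder by blast
  then have \<eta>: "\<eta> \<in> R" "ht S \<alpha>0 \<eta> = 1" unfolding X_def by auto
  define d where "d = \<theta> - 2 *\<^sub>R \<eta>"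
  have ht_d: "ht S \<gamma> d = ht S \<gamma> \<theta> - 2 * ht S \<gamma> \<eta>" for \<gamma> unfolding d_def by (simp add: ht_linear)
  have ints: "\<forall>\<gamma>\<in>S. ht S \<gamma> d \<in> \<int>"
    using ht_Ints[OF theta_root] ht_Ints[OF \<eta>(1)] by (auto simp: ht_d)
  have d_inner: "d \<bullet> \<gamma> = - 2 * (\<eta> \<bullet> \<gamma>)" if "\<gamma> \<in> S" "\<gamma> \<noteq> \<alpha>0" for \<gamma>
    using orth[OF that] unfolding d_def by (simp add: inner_diff_left inner_commute[of \<theta>])
  \<comment> \<open>Adding \<open>s *\<^sub>R \<gamma>\<close> to \<open>\<eta>\<close> keeps the
    \<open>\<alpha>0\<close>-coefficient and changes only the \<open>\<gamma>\<close>-coefficient of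
    \<open>d\<close>, by \<open>- 2 * s\<close>.\<close>
  have step: "\<bar>ht S \<gamma> d - 1/2\<bar> \<le> \<bar>ht S \<gamma> d - 2 * s - 1/2\<bar>"
    if \<gamma>: "\<gamma> \<in> S" "\<gamma> \<noteq> \<alpha>0" and root: "\<eta> + s *\<^sub>R \<gamma> \<in> R" for \<gamma> s
  proof -
    have "\<eta> + s *\<^sub>R \<gamma> \<in> X" using root \<eta> \<gamma> unfolding X_def by (simp add: ht_linear ht_simple)
    from min[OF this] have
      "(\<Sum>\<delta>\<in>S. \<bar>ht S \<delta> d - 1/2\<bar>) \<le> (\<Sum>\<delta>\<in>S. \<bar>ht S \<delta> d - 2 * ht S \<delta> (s *\<^sub>R \<gamma>) - 1/2\<bar>)"
      unfolding \<Phi>_def by (simp add: ht_d ht_add algebra_simps)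
    moreover have "(\<Sum>\<delta>\<in>S - {\<gamma>}. \<bar>ht S \<delta> d - 2 * ht S \<delta> (s *\<^sub>R \<gamma>) - 1/2\<bar>)
        = (\<Sum>\<delta>\<in>S - {\<gamma>}. \<bar>ht S \<delta> d - 1/2\<bar>)"
      using \<gamma> by (intro sum.cong) (auto simp: ht_scale ht_simple)
    ultimately show ?thesis
      using sum.remove[OF finite_S \<gamma>(1), of "\<lambda>\<delta>. \<bar>ht S \<delta> d - 1/2\<bar>"] \<gamma>(1)
        sum.remove[OF finite_S \<gamma>(1), of "\<lambda>\<delta>. \<bar>ht S \<delta> d - 2 * ht S \<delta> (s *\<^sub>R \<gamma>) - 1/2\<bar>"]
      by (simp add: ht_scale ht_simple)
  qed
  have "ht S \<gamma> \<eta> = of_int \<lfloor>ht S \<gamma> \<theta> / 2\<rfloor>" if \<gamma>: "\<gamma> \<in> S" for \<gamma>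
  proof -
    have "\<not> ht S \<gamma> d \<ge> 2"
    proof
      assume "ht S \<gamma> d \<ge> 2"
      then obtain \<delta> where \<delta>: "\<delta> \<in> S" "ht S \<delta> d \<ge> 2" "d \<bullet> \<delta> > 0"
        using ex_large_ht_inner_pos[OF ints \<gamma>] by blast
      \<comment> \<open>The \<open>\<alpha>0\<close>-coefficient of \<open>d\<close> is 2 - 2 = 0,
        so \<open>\<alpha>0\<close> never has to be moved.\<close>
      then have ne: "\<delta> \<noteq> \<alpha>0" using \<alpha>0 \<eta> by (auto simp: ht_d)
      have "ht S \<alpha>0 (\<eta> + \<delta>) = 1" using \<eta> \<delta> ne by (simp add: ht_add ht_simple)
      then have "\<eta> + \<delta> \<noteq> 0" using ht_zero by auto
      then have "\<eta> + \<delta> \<in> R"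
        using add_root[OF \<eta>(1) base_in_R[OF \<delta>(1)]] d_inner[OF \<delta>(1) ne] \<delta>(3) by simp
      then show False using step[OF \<delta>(1) ne, of 1] \<delta>(2) by simp
    qed
    moreover have "\<not> ht S \<gamma> d < 0"
    proof
      assume "ht S \<gamma> d < 0"
      then obtain \<delta> where \<delta>: "\<delta> \<in> S" "ht S \<delta> d < 0" "d \<bullet> \<delta> < 0"
        using ex_neg_ht_inner_neg[OF \<gamma>] by blast
      then have ne: "\<delta> \<noteq> \<alpha>0" using \<alpha>0 \<eta> by (auto simp: ht_d)
      have "\<eta> \<noteq> \<delta>" using \<eta>(2) \<delta>(1) ne by (auto simp: ht_simple)
      then have "\<eta> - \<delta> \<in> R"
        using diff_root[OF \<eta>(1) base_in_R[OF \<delta>(1)]] d_inner[OF \<delta>(1) ne] \<delta>(3) by simp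
      \<comment> \<open>Integrality matters: a value just below 0 would not come closer to 1/2 when
        raised by 2.\<close>
      moreover have "ht S \<delta> d \<le> -1" using ints \<delta> by (auto elim!: Ints_cases dest!: bspec)
      ultimately show False using step[OF \<delta>(1) ne, of "-1"] by simp
    qed
    moreover obtain m n :: int where "ht S \<gamma> \<theta> = m" "ht S \<gamma> \<eta> = n"
      using ht_Ints[OF theta_root \<gamma>] ht_Ints[OF \<eta>(1) \<gamma>] by (auto elim!: Ints_cases)
    ultimately show ?thesis by (simp add: ht_d) linarith
  qed
  then have "half_floor S \<theta> = \<eta>" unfolding half_floor_def using ht_expansion[of \<eta>] by simp
  then show ?thesis using \<eta>(1) by simp
qed

subsection \<open>Non-commutative roots\<close>

lemma ht_half_floor: "\<alpha> \<in> S \<Longrightarrow> ht S \<alpha> (half_floor S \<theta>) = of_int \<lfloor>ht S \<alpha> \<theta> / 2\<rfloor>"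
  unfolding half_floor_def by (simp add: ht_combination)

lemma nc_root_le_half_floor:
  assumes "x \<in> nc_roots R S" shows "root_le S x (half_floor S \<theta>)"
proof -
  have x: "x \<in> R" using assms by (auto simp: nc_roots_def pos_roots_def)
  obtain \<gamma>1 \<gamma>2 where \<gamma>: "root_le S x \<gamma>1" "root_le S x \<gamma>2" "\<gamma>1 + \<gamma>2 \<in> pos_roots R S"
    using assms by (auto simp: nc_roots_def abelian_set_def upper_ideal_def)
  have "ht S \<alpha> (half_floor S \<theta>) - ht S \<alpha> x \<in> \<int> \<and> ht S \<alpha> x \<le> ht S \<alpha> (half_floor S \<theta>)"
    if \<alpha>: "\<alpha> \<in> S" for \<alpha>
  proof -
    obtain n :: int where n: "ht S \<alpha> x = n" using ht_Ints[OF x \<alpha>] by (auto elim!: Ints_cases)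
    have "2 * ht S \<alpha> x \<le> ht S \<alpha> \<theta>"
      using \<gamma> \<alpha> ht_le_theta[OF \<gamma>(3) \<alpha>] unfolding root_le_iff ht_add by fastforce
    \<comment> \<open>As \<open>n\<close> is an integer, the bound by half a coefficient of
      \<open>\<theta>\<close> passes to the floor.\<close>
    then have "n \<le> \<lfloor>ht S \<alpha> \<theta> / 2\<rfloor>" using n by (simp add: le_floor_iff)
    then show ?thesis using n \<alpha> by (simp add: ht_half_floor)
  qed
  then show ?thesis by (simp add: root_le_iff)
qed

lemma half_floor_props:
  assumes "\<not> type_A R"
  shows "half_floor S \<theta> \<in> R" "half_floor S \<theta> \<in> nc_roots R S" "half_floor S \<theta> \<in> heisenberg R S \<theta>"
proof -
  let ?h = "half_floor S \<theta>"
  obtain \<alpha>0 where \<alpha>0: "\<alpha>0 \<in> S" "ht S \<alpha>0 \<theta> = 2" "2 * (\<alpha>0 \<bullet> \<theta>) = \<theta> \<bullet> \<theta>"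
    and orth: "\<And>\<gamma>. \<gamma> \<in> S \<Longrightarrow> \<gamma> \<noteq> \<alpha>0 \<Longrightarrow> \<gamma> \<bullet> \<theta> = 0"
    using ex_unique_nonorthogonal_simple[OF assms] by blast
  show h: "?h \<in> R" using half_floor_root[OF \<alpha>0(1,2) orth] .
  have ht_h: "ht S \<alpha>0 ?h = 1" using \<alpha>0 by (simp add: ht_half_floor)
  have pos: "?h \<in> pos_roots R S" using pos_rootI[OF h \<alpha>0(1)] ht_h by simp
  \<comment> \<open>Only \<open>\<alpha>0\<close> is not orthogonal to \<open>\<theta>\<close>, and
    its coefficient in \<open>?h\<close> is 1.\<close>
  have "?h \<bullet> \<theta> = (\<Sum>\<alpha>\<in>S. if \<alpha> = \<alpha>0 then \<alpha>0 \<bullet> \<theta> else 0)"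
    unfolding inner_expansion[of ?h] using ht_h orth by (intro sum.cong) auto
  then have inner_h: "?h \<bullet> \<theta> = \<alpha>0 \<bullet> \<theta>" using \<alpha>0(1) finite_S by simp
  have "\<theta> \<bullet> \<theta> > 0" using root_inner_pos[OF theta_root] .
  then have "?h \<bullet> \<theta> > 0" using inner_h \<alpha>0(3) by linarith
  then show "?h \<in> heisenberg R S \<theta>"
    using pos by (simp add: heisenberg_def)
  \<comment> \<open>The Cartan integer of \<open>?h\<close> with respect to \<open>\<theta>\<close>
    is 1, so reflection in \<open>\<theta>\<close> subtracts \<open>\<theta>\<close> once.\<close>
  have "?h - \<theta> \<in> R"
    using reflect[OF theta_root h] inner_h \<alpha>0(3) \<open>\<theta> \<bullet> \<theta> > 0\<close> by simp
  then have "\<theta> - ?h \<in> R" using uminus_root by fastforce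
  then have "\<theta> - ?h \<in> pos_roots R S"
    using pos_rootI[OF _ \<alpha>0(1)] ht_h \<alpha>0(2) by (simp add: ht_diff)
  moreover have "root_le S ?h (\<theta> - ?h)"
    unfolding root_le_iff
  proof
    fix \<alpha> assume \<alpha>: "\<alpha> \<in> S"
    obtain m :: int where "ht S \<alpha> \<theta> = m" using ht_Ints[OF theta_root \<alpha>] by (auto elim!: Ints_cases)
    then show "ht S \<alpha> (\<theta> - ?h) - ht S \<alpha> ?h \<in> \<int> \<and> ht S \<alpha> ?h \<le> ht S \<alpha> (\<theta> - ?h)"
      using \<alpha> by (simp add: ht_diff ht_half_floor) linarith
  qed
  \<comment> \<open>The pair \<open>?h\<close>, \<open>\<theta> - ?h\<close> lies in the upper ideal
    of \<open>?h\<close> and sums to the root \<open>\<theta>\<close>.\<close>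
  ultimately show "?h \<in> nc_roots R S"
    using pos root_le_refl theta_pos
    unfolding nc_roots_def abelian_set_def upper_ideal_def by force
qed

end

theorem theorem3p5:
  fixes R S :: "'a::euclidean_space set" and \<theta> :: 'a
  assumes "root_system R" and "reduced_rs R" and "irreducible_rs R" and "\<not> type_A R"
    and "is_base R S"
    and "\<theta> \<in> pos_roots R S" and "\<forall>\<beta>\<in>pos_roots R S. root_le S \<beta> \<theta>"
  shows "half_floor S \<theta> \<in> R
    \<and> is_maximal_in S (nc_roots R S) (half_floor S \<theta>)
    \<and> (\<forall>m. is_maximal_in S (nc_roots R S) m \<longrightarrow> m = half_floor S \<theta>)
    \<and> half_floor S \<theta> \<in> heisenberg R S \<theta>"
proof -
  interpret highest_root_system R S \<theta>
    using assms by unfold_locales auto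
  note half_floor = half_floor_props[OF assms(4)]
  have "is_maximal_in S (nc_roots R S) (half_floor S \<theta>)"
    using half_floor(2) nc_root_le_half_floor root_le_antisym unfolding is_maximal_in_def by blast
  \<comment> \<open>The element is greatest, not merely maximal, which gives uniqueness.\<close>
  moreover have "m = half_floor S \<theta>" if m: "is_maximal_in S (nc_roots R S) m" for m
  proof -
    have "root_le S m (half_floor S \<theta>)"
      using m nc_root_le_half_floor unfolding is_maximal_in_def by blast
    then show ?thesis using m half_floor(2) unfolding is_maximal_in_def by metis
  qed
  ultimately show ?thesis using half_floor(1,3) by (intro conjI allI impI)
qed

end
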